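(* Let $p$ be an odd prime and $d\ge 1$. Let $C$ be any $\mathrm{AC}^0[p]$ circuit of depth $d$ on $n$ inputs such that $C^{-1}(1)\subseteq \textsc{Parity}_n^{-1}(1)$. Then \[ \Pr_{x\sim\{0,1\}^n}[C(x)=\textsc{Parity}_n(x)]\;\le\;\frac12+|C|\cdot 2^{-n^{\Omega(1/d)}}, \] where $|C|$ is the number of gates of $C$, $x$ is uniform on $\{0,1\}^n$, and the constant implicit in $\Omega(\cdot)$ does not depend on $n$, $d$ or $C$.
   Context: $\textsc{Parity}_n(x)=1$ iff the number of ones in $x\in\{0,1\}^n$ is odd. An $\mathrm{AC}^0[p]$ circuit is a circuit consisting of NOT gates and unbounded fan-in AND, OR and $\mathrm{MOD}_p$ gates (a $\mathrm{MOD}_p$ gate outputs $1$ iff the number of ones among its inputs is not divisible by $p$); its depth is the length of the longest input-to-output path. *)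

theory Defs
  imports "HOL-Probability.Probability" "HOL-Computational_Algebra.Primes"
begin

definition cube :: "nat \<Rightarrow> bool list set" where
  "cube n = {x. length x = n}"

definition parity :: "bool list \<Rightarrow> bool" where
  "parity x \<longleftrightarrow> odd (count_list x True)"

text \<open>
  A circuit is a finite directed acyclic graph, presented by listing its gates in a topological
  order. A node is either an input variable or the gate at a given position of the list.
  The nodes feeding an unbounded fan-in gate form a set, i.e. the graph has no parallel edges
  (distinct gates computing the same function are still distinct nodes). This matters for small
  inputs: with parallel edges, a single MOD gate reading one bit once and another bit \<open>p - 1\<close>
  times would compute the parity of two bits exactly, violating the bound for \<open>n = 2\<close>.
  Fan-in 0 is allowed, which provides the constants.
\<close>

datatype node = Input nat | Gate nat

datatype gate =
    Not_Gate node
  | And_Gate "node set"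
  | Or_Gate "node set"
  | Mod_Gate "node set"

datatype circuit = Circuit (gates: "gate list") (out_node: node)

fun gate_inputs :: "gate \<Rightarrow> node set" where
  "gate_inputs (Not_Gate u) = {u}"
| "gate_inputs (And_Gate U) = U"
| "gate_inputs (Or_Gate U) = U"
| "gate_inputs (Mod_Gate U) = U"

definition circuit_on :: "nat \<Rightarrow> circuit \<Rightarrow> bool" where
  "circuit_on n C \<longleftrightarrow>
     (\<forall>i < length (gates C). gate_inputs (gates C ! i) \<subseteq> Input ` {..<n} \<union> Gate ` {..<i}) \<and>
     out_node C \<in> Input ` {..<n} \<union> Gate ` {..<length (gates C)}"

fun gate_value :: "nat \<Rightarrow> (node \<Rightarrow> bool) \<Rightarrow> gate \<Rightarrow> bool" where
  "gate_value p v (Not_Gate u) \<longleftrightarrow> \<not> v u"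
| "gate_value p v (And_Gate U) \<longleftrightarrow> (\<forall>u\<in>U. v u)"
| "gate_value p v (Or_Gate U) \<longleftrightarrow> (\<exists>u\<in>U. v u)"
| "gate_value p v (Mod_Gate U) \<longleftrightarrow> \<not> p dvd card {u \<in> U. v u}"

text \<open>Here \<open>x\<close> holds the input bits and \<open>vs\<close> the values of the gates evaluated so far.\<close>

fun node_value :: "bool list \<Rightarrow> bool list \<Rightarrow> node \<Rightarrow> bool" where
  "node_value x vs (Input i) = x ! i"
| "node_value x vs (Gate j) = vs ! j"

definition gate_values :: "nat \<Rightarrow> bool list \<Rightarrow> gate list \<Rightarrow> bool list" where
  "gate_values p x gs = foldl (\<lambda>vs g. vs @ [gate_value p (node_value x vs) g]) [] gs"

definition circuit_value :: "nat \<Rightarrow> circuit \<Rightarrow> bool list \<Rightarrow> bool" where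
  "circuit_value p C x = node_value x (gate_values p x (gates C)) (out_node C)"

definition num_gates :: "circuit \<Rightarrow> nat" where
  "num_gates C = length (gates C)"

definition edges :: "circuit \<Rightarrow> (node \<times> node) set" where
  "edges C = {(u, Gate i) | u i. i < length (gates C) \<and> u \<in> gate_inputs (gates C ! i)}"

text \<open>
  The length of a longest path from an input variable to the output. The supremum is 0 if the
  output is not reachable from any input variable, in which case the circuit is constant.
\<close>

definition depth :: "circuit \<Rightarrow> nat" where
  "depth C = Sup {k. \<exists>i. (Input i, out_node C) \<in> edges C ^^ k}"

end

theory Submission
  imports Defs "HOL-Number_Theory.Residues"
begin

text \<open>
  Let \<open>S\<close> be the set of accepted inputs; the circuit agrees with parity on \<open>S\<close> and on the even
  half of the cube, so \<open>S\<close> has to be shown small. Off a set \<open>E\<close> of density at most \<open>s * 2 ^ -r\<close>,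
  the Razborov-Smolensky method yields a polynomial \<open>P\<close> over the field with \<open>p\<close> elements, of
  degree \<open>(r * (p - 1)) ^ d\<close>, that computes the circuit. A polynomial of degree less than \<open>n / 2\<close>
  supported on odd points vanishes. Hence every \<open>Q\<close> of degree a little below \<open>n / 2\<close> that vanishes
  on \<open>E\<close> also vanishes on \<open>S\<close>, as \<open>P * Q\<close> is supported on \<open>S\<close>. Since polynomials of degree \<open>k\<close>
  interpolate arbitrary values on Hamming balls of radius \<open>k\<close>, and some such ball contains a
  constant fraction of \<open>S\<close>, this forces \<open>card S \<le> 4 * card E\<close>.
\<close>

section \<open>The cube and parity\<close>

lemma cube_eq: "cube n = {x. set x \<subseteq> UNIV \<and> length x = n}"
  by (auto simp: cube_def)

lemma finite_cube [simp]: "finite (cube n)"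
  unfolding cube_eq by (rule finite_lists_length_eq) simp

lemma card_cube [simp]: "card (cube n) = 2 ^ n"
  unfolding cube_eq by (subst card_lists_length_eq) simp_all

lemma cube_nonempty [simp]: "cube n \<noteq> {}"
  using card_cube[of n] by (metis card.empty power_eq_0_iff zero_neq_numeral)

definition flip :: "nat \<Rightarrow> bool list \<Rightarrow> bool list" where
  "flip i x = x[i := \<not> x ! i]"

lemma length_flip [simp]: "length (flip i x) = length x"
  by (simp add: flip_def)

lemma flip_in_cube [simp]: "flip i x \<in> cube n \<longleftrightarrow> x \<in> cube n"
  by (simp add: flip_def cube_def)

lemma flip_nth_other [simp]: "j \<noteq> i \<Longrightarrow> flip i x ! j = x ! j"
  by (simp add: flip_def)

lemma flip_flip [simp]: "flip i (flip i x) = x"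
  by (cases "i < length x") (simp_all add: flip_def list_update_beyond)

lemma parity_flip [simp]:
  assumes "i < length x"
  shows "parity (flip i x) \<longleftrightarrow> \<not> parity x"
proof -
  have "x = take i x @ x ! i # drop (Suc i) x"
    using assms by (rule id_take_nth_drop)
  then have "count_list x True
      = count_list (take i x @ x ! i # drop (Suc i) x) True"
    by (rule arg_cong)
  then show ?thesis
    using assms by (simp add: parity_def flip_def upd_conv_take_nth_drop)
qed

lemma parity_conv_card: "parity x \<longleftrightarrow> odd (card {i. i < length x \<and> x ! i})"
proof -
  have "count_list x True = length (filter id x)"
    by (induction x) auto
  then show ?thesis
    by (simp add: parity_def length_filter_conv_card)
qed

lemma flip_image_odd:
  assumes "i < n"
  shows "flip i ` {x \<in> cube n. parity x} = {x \<in> cube n. \<not> parity x}"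
proof (intro equalityI subsetI)
  fix x assume "x \<in> {x \<in> cube n. \<not> parity x}"
  then have "flip i x \<in> {x \<in> cube n. parity x}" "x = flip i (flip i x)"
    using assms by (auto simp: cube_def)
  then show "x \<in> flip i ` {x \<in> cube n. parity x}"
    by blast
qed (use assms in \<open>auto simp: cube_def\<close>)

lemma inj_flip: "inj_on (flip i) A"
  by (metis flip_flip inj_onI)

text \<open>Flipping a fixed coordinate matches the odd points with the even ones;
  \<open>n > 0\<close> provides a coordinate.\<close>

lemma card_even_points:
  assumes "n > 0"
  shows "2 * card {x \<in> cube n. \<not> parity x} = 2 ^ n"
    and "2 * card {x \<in> cube n. parity x} = 2 ^ n"
proof -
  have "card {x \<in> cube n. parity x} = card {x \<in> cube n. \<not> parity x}"
    using card_image[OF inj_flip] flip_image_odd[OF assms] by metis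
  moreover have "card {x \<in> cube n. parity x} + card {x \<in> cube n. \<not> parity x} = 2 ^ n"
    by (subst card_Un_disjoint[symmetric])
      (auto intro!: arg_cong[where f = card] simp flip: card_cube)
  ultimately show "2 * card {x \<in> cube n. \<not> parity x} = 2 ^ n"
    and "2 * card {x \<in> cube n. parity x} = 2 ^ n"
    by simp_all
qed

section \<open>Functions of low degree\<close>

text \<open>
  Up to agreement on the cube these are the polynomials of degree at most \<open>k\<close>, described without
  coordinates as sums of functions of at most \<open>k\<close> variables. Polynomials over the field with
  \<open>p\<close> elements are represented by integer-valued functions, compared modulo \<open>p\<close>.
\<close>

inductive degree_le :: "nat \<Rightarrow> (bool list \<Rightarrow> int) \<Rightarrow> bool" for k where
  junta: "finite A \<Longrightarrow> card A \<le> k \<Longrightarrow> (\<forall>x y. (\<forall>i\<in>A. x ! i = y ! i) \<longrightarrow> f x = f y) \<Longrightarrow> degree_le k f"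
| add: "degree_le k f \<Longrightarrow> degree_le k g \<Longrightarrow> degree_le k (\<lambda>x. f x + g x)"

lemma degree_le_mono:
  assumes "degree_le k f" "k \<le> l"
  shows "degree_le l f"
  using assms(1)
proof induction
  case (junta A f)
  with assms(2) show ?case
    by (intro degree_le.junta[of A]) auto
qed (rule degree_le.add)

lemma degree_le_const: "degree_le k (\<lambda>_. c)"
  by (rule degree_le.junta[of "{}"]) simp_all

lemma degree_le_sum:
  assumes "\<And>a. a \<in> A \<Longrightarrow> degree_le k (f a)"
  shows "degree_le k (\<lambda>x. \<Sum>a\<in>A. f a x)"
  using assms
  by (induction A rule: infinite_finite_induct)
    (simp_all add: degree_le_const degree_le.add)

lemma degree_le_mult:
  assumes "degree_le k f" "degree_le l g"
  shows "degree_le (k + l) (\<lambda>x. f x * g x)"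
  using assms(1)
proof induction
  case (junta A f)
  note A = junta
  show ?case
    using assms(2)
  proof induction
    case (junta B g)
    show ?case
    proof (rule degree_le.junta)
      show "card (A \<union> B) \<le> k + l"
        using card_Un_le[of A B] A junta by linarith
      show "\<forall>x y. (\<forall>i\<in>A \<union> B. x ! i = y ! i) \<longrightarrow> f x * g x = f y * g y"
        using A(3) junta(3) by (metis UnCI)
    qed (use A junta in simp)
  next
    case (add g h)
    then show ?case
      using degree_le.add[OF add.IH] by (simp add: algebra_simps)
  qed
next
  case (add f h)
  then show ?case
    using degree_le.add[OF add.IH] by (simp add: algebra_simps)
qed

lemma degree_le_diff:
  assumes "degree_le k f" "degree_le k g"
  shows "degree_le k (\<lambda>x. f x - g x)"
  using degree_le.add[OF assms(1) degree_le_mult[OF degree_le_const[of 0 "-1"] assms(2), simplified]]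
  by simp

lemma degree_le_prod:
  assumes "\<And>a. a \<in> A \<Longrightarrow> degree_le k (f a)"
  shows "degree_le (card A * k) (\<lambda>x. \<Prod>a\<in>A. f a x)"
  using assms
proof (induction A rule: infinite_finite_induct)
  case (insert a A)
  then show ?case
    using degree_le_mult[of k "f a" "card A * k" "\<lambda>x. \<Prod>a\<in>A. f a x"] by simp
qed (simp_all add: degree_le_const)

lemma degree_le_power:
  assumes "degree_le k f"
  shows "degree_le (m * k) (\<lambda>x. f x ^ m)"
  using degree_le_prod[of "{..<m}" k "\<lambda>_. f"] assms by simp

lemma degree_le_nth_prod:
  assumes "finite A"
  shows "degree_le (card A) (\<lambda>x. \<Prod>i\<in>A. f i (x ! i))"
  by (rule degree_le.junta[OF assms]) (auto intro: prod.cong)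

text \<open>A function of fewer than \<open>n\<close> variables ignores some coordinate
  \<open>i\<close>, while flipping \<open>i\<close> reverses the sign, so the sum equals its own
  negative. Linearity extends this to sums of such functions.\<close>

lemma sum_sign_mult_eq_0:
  assumes "degree_le k f" "k < n"
  shows "(\<Sum>x\<in>cube n. (if parity x then -1 else 1) * f x) = 0"
  using assms(1)
proof induction
  case (junta A f)
  have "\<not> {..<n} \<subseteq> A"
    using card_mono[of A "{..<n}"] junta(1,2) assms(2) by auto
  then obtain i where i: "i < n" "i \<notin> A"
    by blast
  have "f (flip i x) = f x" for x
    using i(2) by (intro junta(3)[rule_format] flip_nth_other) auto
  then have "(\<Sum>x\<in>cube n. (if parity x then -1 else 1) * f x)
      = (\<Sum>x\<in>cube n. - ((if parity x then -1 else 1) * f x))"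
    using i(1)
    by (intro sum.reindex_bij_witness[of _ "flip i" "flip i"]) (auto simp: cube_def)
  then show ?case
    by (simp add: sum_negf)
next
  case (add f g)
  then show ?case
    by (simp add: distrib_left sum.distrib)
qed

text \<open>The sign of the parity is the character of the full index set, which is why multiplying
  by it complements the set of a character.\<close>

lemma prod_sign_eq_parity:
  "(\<Prod>i<length x. if x ! i then -1 else 1) = (if parity x then -1 else (1 :: int))"
proof -
  have "(\<Prod>i<length x. if x ! i then -1 else 1) = (-1 :: int) ^ card {i. i < length x \<and> x ! i}"
    by (subst prod.If_cases) (auto simp: Int_def intro!: arg_cong[where f = card])
  then show ?thesis
    by (simp add: parity_conv_card)
qed

text \<open>
  Multiplication by the sign \<open>s\<close> of the parity exchanges the characters of sets \<open>A\<close> and of their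
  complements. As \<open>s * f\<close> agrees with \<open>-f\<close> modulo \<open>p\<close>, orthogonality of \<open>f\<close> to a character of
  either low or high degree follows from the orthogonality of \<open>s\<close> to functions of degree less than
  \<open>n\<close>. Hence \<open>f\<close> has no nonzero Fourier coefficient modulo \<open>p\<close>.
\<close>

lemma degree_le_odd_support:
  assumes p: "prime p" "odd p" and f: "degree_le m f" and m: "2 * m < n"
    and even: "\<And>x. x \<in> cube n \<Longrightarrow> \<not> parity x \<Longrightarrow> int p dvd f x"
    and z: "z \<in> cube n"
  shows "int p dvd f z"
proof -
  define e :: "bool \<Rightarrow> int" where "e b = (if b then -1 else 1)" for b
  define ch where "ch A x = (\<Prod>i\<in>A. e (x ! i))" for A x
  define s :: "bool list \<Rightarrow> int" where "s x = (if parity x then -1 else 1)" for x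
  have e_sq: "e b * e b = 1" for b
    by (simp add: e_def)
  have orth: "(\<Sum>x\<in>cube n. s x * (f x * ch A x)) = 0" if "finite A" "card A + m < n" for A
    unfolding s_def ch_def
    by (rule sum_sign_mult_eq_0[of "m + card A"], rule degree_le_mult[OF f degree_le_nth_prod[where f = "\<lambda>_. e"]])
      (use that in simp_all)
  have coeff: "int p dvd (\<Sum>x\<in>cube n. f x * ch A x)" if A: "A \<subseteq> {..<n}" for A
  proof (cases "card A + m < n")
    case True
    have "finite A"
      using A finite_subset by blast
    \<comment> \<open>At even points \<open>f\<close> is a multiple of \<open>p\<close>; at odd
      points \<open>f x + s x * f x\<close> is zero.\<close>
    have "int p dvd (\<Sum>x\<in>cube n. (f x + s x * f x) * ch A x)"
      by (intro dvd_sum dvd_mult2) (auto simp: s_def intro: even dvd_mult)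
    also have "\<dots> = (\<Sum>x\<in>cube n. f x * ch A x) + (\<Sum>x\<in>cube n. s x * (f x * ch A x))"
      by (simp add: algebra_simps sum.distrib)
    finally show ?thesis
      using orth[OF \<open>finite A\<close> True] by simp
  next
    case False
    have "ch A x = s x * ch ({..<n} - A) x" if "x \<in> cube n" for x
    proof -
      have "s x = ch {..<n} x"
        using prod_sign_eq_parity[of x] that by (simp add: s_def ch_def e_def cube_def)
      also have "\<dots> = ch A x * ch ({..<n} - A) x"
        unfolding ch_def using prod.subset_diff[OF A] by (simp add: mult.commute)
      finally have "s x * ch ({..<n} - A) x = ch A x * (ch ({..<n} - A) x * ch ({..<n} - A) x)"
        by (simp add: mult.assoc)
      also have "ch ({..<n} - A) x * ch ({..<n} - A) x = 1"
        by (simp add: ch_def e_sq flip: prod.distrib)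
      finally show ?thesis
        by simp
    qed
    then have "(\<Sum>x\<in>cube n. f x * ch A x) = (\<Sum>x\<in>cube n. s x * (f x * ch ({..<n} - A) x))"
      by (intro sum.cong) (simp_all add: algebra_simps)
    \<comment> \<open>The complement of \<open>A\<close> has at most \<open>m\<close> elements here,
      so the degrees add up to at most \<open>2 * m\<close>, which is below
      \<open>n\<close>.\<close>
    also have "\<dots> = 0"
      using False m A by (intro orth) (auto simp: card_Diff_subset finite_subset)
    finally show ?thesis
      by simp
  qed
  have delta: "(\<Sum>A\<in>Pow {..<n}. ch A z * ch A x) = (if x = z then 2 ^ n else 0)"
    if x: "x \<in> cube n" for x
  proof -
    have "(\<Sum>A\<in>Pow {..<n}. ch A z * ch A x) = (\<Prod>i<n. e (z ! i) * e (x ! i) + 1)"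
      by (subst prod_add) (simp_all add: ch_def prod.distrib)
    also have "\<dots> = (if x = z then 2 ^ n else 0)"
    proof (cases "x = z")
      case False
      then obtain i where "i < n" "x ! i \<noteq> z ! i"
        using x z by (auto simp: cube_def list_eq_iff_nth_eq)
      then have "e (z ! i) * e (x ! i) + 1 = 0"
        by (auto simp: e_def)
      with \<open>i < n\<close> False show ?thesis
        by (auto intro!: prod_zero)
    qed (simp add: e_sq)
    finally show ?thesis .
  qed
  \<comment> \<open>Fourier inversion at \<open>z\<close>: this combination of coefficients is
    \<open>f z * 2 ^ n\<close>, and \<open>2 ^ n\<close> is invertible modulo the odd
    \<open>p\<close>.\<close>
  have "int p dvd (\<Sum>A\<in>Pow {..<n}. ch A z * (\<Sum>x\<in>cube n. f x * ch A x))"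
    by (intro dvd_sum dvd_mult coeff) auto
  also have "\<dots> = (\<Sum>x\<in>cube n. f x * (\<Sum>A\<in>Pow {..<n}. ch A z * ch A x))"
    by (subst sum_distrib_left, subst sum.swap)
      (simp add: sum_distrib_left mult.left_commute)
  also have "\<dots> = f z * 2 ^ n"
    using z by (simp add: delta if_distrib sum.delta cong: if_cong)
  finally have "int p dvd f z * 2 ^ n" .
  moreover have "coprime (int p) (2 ^ n)"
    using p(2) by (simp add: coprime_right_2_iff_odd)
  ultimately show ?thesis
    by (simp add: coprime_dvd_mult_left_iff)
qed

section \<open>Interpolation on Hamming balls\<close>

text \<open>On lists of equal length its cardinality is the Hamming distance. The set itself is kept
  because \<open>diff_set a\<close> identifies the cube with a power set, sending \<open>a\<close>
  to the empty set.\<close>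

definition diff_set :: "bool list \<Rightarrow> bool list \<Rightarrow> nat set" where
  "diff_set a x = {i. i < length a \<and> a ! i \<noteq> x ! i}"

lemma finite_diff_set [simp]: "finite (diff_set a x)"
  by (simp add: diff_set_def)

lemma diff_set_commute: "length a = length x \<Longrightarrow> diff_set a x = diff_set x a"
  by (auto simp: diff_set_def)

lemma bij_betw_diff_set:
  assumes "a \<in> cube n"
  shows "bij_betw (diff_set a) (cube n) (Pow {..<n})"
proof (rule bij_betw_byWitness[where f' = "\<lambda>B. map (\<lambda>i. (i \<in> B) \<noteq> a ! i) [0..<n]"])
  show "\<forall>x\<in>cube n. map (\<lambda>i. (i \<in> diff_set a x) \<noteq> a ! i) [0..<n] = x"
    using assms by (simp add: cube_def diff_set_def list_eq_iff_nth_eq) blast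
  show "\<forall>B\<in>Pow {..<n}. diff_set a (map (\<lambda>i. (i \<in> B) \<noteq> a ! i) [0..<n]) = B"
    using assms by (auto simp: cube_def diff_set_def)
qed (use assms in \<open>auto simp: cube_def diff_set_def\<close>)

lemma card_hamming_ball:
  assumes "a \<in> cube n"
  shows "card {x \<in> cube n. card (diff_set a x) \<le> k} = (\<Sum>i\<le>k. n choose i)"
proof -
  have "bij_betw (diff_set a) {x \<in> cube n. card (diff_set a x) \<le> k}
      {B \<in> Pow {..<n}. card B \<le> k}"
    by (rule bij_betw_Collect[OF bij_betw_diff_set[OF assms]]) simp
  then have "card {x \<in> cube n. card (diff_set a x) \<le> k} = card {B \<in> Pow {..<n}. card B \<le> k}"
    by (rule bij_betw_same_card)
  also have "{B \<in> Pow {..<n}. card B \<le> k} = (\<Union>i\<le>k. {B. B \<subseteq> {..<n} \<and> card B = i})"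
    by auto
  also have "card \<dots> = (\<Sum>i\<le>k. n choose i)"
    by (subst card_UN_disjoint) (auto simp: n_subsets)
  finally show ?thesis .
qed

text \<open>Points are added in order of distance from \<open>a\<close>. The indicator
  \<open>h\<close> of differing from \<open>a\<close> on all of \<open>diff_set a z\<close> has
  degree at most \<open>k\<close>, is 1 at \<open>z\<close> and vanishes at every other point that
  is no farther from \<open>a\<close>. Adding a multiple of it therefore corrects the value at
  \<open>z\<close> without disturbing the earlier ones.\<close>

lemma interpolation:
  assumes "finite T" "T \<subseteq> cube n" "a \<in> cube n" "\<And>x. x \<in> T \<Longrightarrow> card (diff_set a x) \<le> k"
  shows "\<exists>q. degree_le k q \<and> (\<forall>x\<in>T. q x = f x)"
  using assms(1,2,4)
proof (induction T rule: finite_ranking_induct[where f = "\<lambda>x. card (diff_set a x)"])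
  case empty
  show ?case
    using degree_le_const by blast
next
  case (insert z S)
  then obtain q where q: "degree_le k q" "\<And>x. x \<in> S \<Longrightarrow> q x = f x"
    by auto
  show ?case
  \<comment> \<open>The ranking induction may insert a point that is already present.\<close>
  proof (cases "z \<in> S")
    case True
    then show ?thesis
      using q by (auto simp: insert_absorb)
  next
    case False
    define h where "h x = (\<Prod>i\<in>diff_set a z. of_bool (a ! i \<noteq> x ! i) :: int)" for x
    have "degree_le k h"
      unfolding h_def using insert.prems
      by (intro degree_le_mono[OF
            degree_le_nth_prod[where f = "\<lambda>i b. of_bool (a ! i \<noteq> b)"]]) auto
    then have deg: "degree_le k (\<lambda>x. q x + (f z - q z) * h x)"
      using degree_le.add[OF q(1) degree_le_mult[OF degree_le_const[of 0 "f z - q z"] \<open>degree_le k h\<close>, simplified]]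
      by simp
    have "h z = 1"
      by (simp add: h_def diff_set_def)
    moreover have "h y = 0" if y: "y \<in> S" for y
    proof -
      have "\<not> diff_set a z \<subseteq> diff_set a y"
      proof
        assume "diff_set a z \<subseteq> diff_set a y"
        then have "diff_set a z = diff_set a y"
          using insert.hyps(2)[OF y] by (intro card_seteq) auto
        then have "z = y"
          using insert.prems y bij_betw_imp_inj_on[OF bij_betw_diff_set[OF assms(3)]]
          by (auto dest: inj_onD)
        with False y show False
          by simp
      qed
      then show ?thesis
        unfolding h_def by (intro prod_zero) (auto simp: diff_set_def)
    qed
    ultimately show ?thesis
      using deg q(2) by (intro exI[of _ "\<lambda>x. q x + (f z - q z) * h x"]) auto
  qed
qed

text \<open>Averaging over all centres: as distance is symmetric, each point of \<open>S\<close>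
  lies in the balls around exactly \<open>\<Sum>i\<le>k. n choose i\<close> of the
  \<open>2 ^ n\<close> centres.\<close>

lemma exists_dense_ball:
  assumes "S \<subseteq> cube n"
  shows "\<exists>a\<in>cube n. card S * (\<Sum>i\<le>k. n choose i) \<le> 2 ^ n * card {x \<in> S. card (diff_set a x) \<le> k}"
proof (rule ccontr)
  assume "\<not> ?thesis"
  then have less: "2 ^ n * card {x \<in> S. card (diff_set a x) \<le> k} < card S * (\<Sum>i\<le>k. n choose i)"
    if "a \<in> cube n" for a
    using that by (meson not_le)
  have S: "finite S"
    using finite_subset[OF assms finite_cube] .
  have "(\<Sum>a\<in>cube n. card {x \<in> S. card (diff_set a x) \<le> k})
      = (\<Sum>x\<in>S. card {a \<in> cube n. card (diff_set a x) \<le> k})"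
    using sum_multicount_gen[of "cube n" S "\<lambda>a x. card (diff_set a x) \<le> k"] S by simp
  also have "\<dots> = (\<Sum>x\<in>S. card {a \<in> cube n. card (diff_set x a) \<le> k})"
    using assms
    by (intro sum.cong arg_cong[where f = card] Collect_cong conj_cong)
      (auto simp: cube_def diff_set_commute)
  also have "\<dots> = card S * (\<Sum>i\<le>k. n choose i)"
    using assms by (simp add: card_hamming_ball subset_iff)
  finally have "(\<Sum>a\<in>cube n. 2 ^ n * card {x \<in> S. card (diff_set a x) \<le> k})
      = (\<Sum>a\<in>cube n. card S * (\<Sum>i\<le>k. n choose i))"
    by (simp add: sum_distrib_left[symmetric])
  moreover have "(\<Sum>a\<in>cube n. 2 ^ n * card {x \<in> S. card (diff_set a x) \<le> k})
      < (\<Sum>a\<in>cube n. card S * (\<Sum>i\<le>k. n choose i))"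
    by (rule sum_strict_mono) (use less in auto)
  ultimately show False
    by simp
qed

text \<open>
  If the bound fails, then a Hamming ball contains more than \<open>card E\<close> points of \<open>S\<close>, so that by
  counting two interpolating polynomials agree on \<open>E\<close> but not on \<open>S\<close>. Their difference times \<open>f\<close>
  is nonzero and supported on \<open>S\<close>, contradicting \<open>degree_le_odd_support\<close>.
\<close>

lemma odd_support_bound:
  assumes p: "prime p" "odd p" and f: "degree_le m f" and k: "2 * (m + k) < n"
    and S: "S \<subseteq> {x \<in> cube n. parity x}" and E: "E \<subseteq> cube n"
    and approx: "\<And>x. x \<in> cube n - E \<Longrightarrow> [f x = of_bool (x \<in> S)] (mod int p)"
  shows "card S * (\<Sum>i\<le>k. n choose i) \<le> 2 ^ n * card E"
proof -
  have "S \<subseteq> cube n"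
    using S by auto
  then obtain a where a: "a \<in> cube n"
      "card S * (\<Sum>i\<le>k. n choose i) \<le> 2 ^ n * card {x \<in> S. card (diff_set a x) \<le> k}"
    using exists_dense_ball by blast
  define T where "T = {x \<in> S. card (diff_set a x) \<le> k}"
  have finite: "finite T" "finite E"
    using \<open>S \<subseteq> cube n\<close> E by (auto simp: T_def intro: finite_subset)
  have "p > 1"
    using p(1) by (rule prime_gt_1_nat)
  have "card T \<le> card E"
  proof (rule ccontr)
    assume less: "\<not> card T \<le> card E"
    \<comment> \<open>Assignments of residues to the points of \<open>A\<close>; there are
      \<open>p ^ card A\<close> of them. Hence sending values on \<open>T\<close> to the residues on
      \<open>E\<close> of their interpolant cannot be injective.\<close>
    define G where "G A = (A \<rightarrow>\<^sub>E {0..<int p})" for A :: "bool list set"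
    have "\<forall>g. \<exists>q. degree_le k q \<and> (\<forall>x\<in>T. q x = g x)"
      by (rule allI, rule interpolation[OF finite(1) _ a(1)])
        (use \<open>S \<subseteq> cube n\<close> in \<open>auto simp: T_def\<close>)
    from choice[OF this] obtain q where q: "\<And>g. degree_le k (q g)" "\<And>g x. x \<in> T \<Longrightarrow> q g x = g x"
      by blast
    define r where "r g = restrict (\<lambda>x. q g x mod int p) E" for g
    have "r ` G T \<subseteq> G E"
      using \<open>p > 1\<close> by (auto simp: r_def G_def)
    moreover have "card (G E) < card (G T)"
      using less finite \<open>p > 1\<close> by (simp add: G_def card_PiE)
    moreover have "finite (G E)"
      using finite by (simp add: G_def finite_PiE)
    ultimately have "\<not> inj_on r (G T)"
      using card_inj_on_le by (metis not_le)
    then obtain g h where gh: "g \<in> G T" "h \<in> G T" "g \<noteq> h" "r g = r h"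
      by (auto simp: inj_on_def)
    then obtain z where z: "z \<in> T" "g z \<noteq> h z"
      unfolding G_def by (meson PiE_ext)
    have z_cube: "z \<in> cube n" "z \<in> S"
      using z(1) S by (auto simp: T_def)
    have dvd_E: "int p dvd q g x - q h x" if "x \<in> E" for x
      using fun_cong[OF gh(4), of x] that by (simp add: r_def mod_eq_dvd_iff)
    \<comment> \<open>Both values are reduced residues, so being distinct they are
      incongruent.\<close>
    have "g z mod int p = g z" "h z mod int p = h z"
      using gh(1,2) z(1) by (auto simp: G_def PiE_iff)
    then have not_dvd: "\<not> int p dvd q g z - q h z"
      using q(2)[OF z(1)] z(2) by (metis mod_eq_dvd_iff)
    then have "z \<notin> E"
      using dvd_E by blast
    then have "[f z = 1] (mod int p)"
      using approx[of z] z_cube by simp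
    then have "\<not> int p dvd f z"
      using \<open>p > 1\<close> by (auto dest: cong_dvd_iff)
    have "int p dvd f z * (q g z - q h z)"
    proof (rule degree_le_odd_support[OF p _ k])
      show "degree_le (m + k) (\<lambda>x. f x * (q g x - q h x))"
        by (intro degree_le_mult degree_le_diff f q)
      show "int p dvd f x * (q g x - q h x)" if "x \<in> cube n" "\<not> parity x" for x
      proof (cases "x \<in> E")
        case False
        moreover have "x \<notin> S"
          using that S by auto
        ultimately have "[f x = 0] (mod int p)"
          using approx[of x] that by simp
        then show ?thesis
          by (simp add: cong_0_iff)
      qed (simp add: dvd_E)
    qed (rule z_cube(1))
    with \<open>\<not> int p dvd f z\<close> not_dvd p(1) show False
      by (simp add: prime_dvd_mult_iff)
  qed
  then have "2 ^ n * card T \<le> 2 ^ n * card E"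
    by simp
  with a(2) show ?thesis
    unfolding T_def by linarith
qed

section \<open>Approximation of single gates\<close>

text \<open>For a fixed \<open>x\<close> with a true input \<open>w\<close>, toggling the membership
  of \<open>w\<close> in \<open>A\<close> changes the count by one, so at most half of all subsets
  \<open>A\<close> have a count divisible by \<open>p\<close>. Averaging over the subsets yields one
  that works for at least half of \<open>B\<close>.\<close>

lemma exists_hitting_set:
  assumes U: "finite U" and B: "finite B" and p: "p > 1"
    and v: "\<And>x. x \<in> B \<Longrightarrow> \<exists>u\<in>U. v x u"
  shows "\<exists>A\<subseteq>U. 2 * card {x \<in> B. p dvd card {u \<in> A. v x u}} \<le> card B"
proof (rule ccontr)
  assume "\<not> ?thesis"
  then have less: "card B < 2 * card {x \<in> B. p dvd card {u \<in> A. v x u}}" if "A \<subseteq> U" for A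
    using that by (meson not_le)
  have half: "2 * card {A \<in> Pow U. p dvd card {u \<in> A. v x u}} \<le> 2 ^ card U" if x: "x \<in> B" for x
  proof -
    define bad where "bad = {A \<in> Pow U. p dvd card {u \<in> A. v x u}}"
    obtain w where w: "w \<in> U" "v x w"
      using v[OF x] by blast
    define toggle where "toggle A = (if w \<in> A then A - {w} else insert w A)" for A
    have toggle_toggle: "toggle (toggle A) = A" for A
      by (auto simp: toggle_def)
    have insert_w: "card {u \<in> insert w A. v x u} = Suc (card {u \<in> A. v x u})"
      if "A \<subseteq> U" "w \<notin> A" for A
    proof -
      have "{u \<in> insert w A. v x u} = insert w {u \<in> A. v x u}"
        using w(2) by auto
      then show ?thesis
        using that finite_subset[OF that(1) U] by simp
    qed
    have not_both: "\<not> (p dvd m \<and> p dvd Suc m)" for m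
      using p by (metis dvd_add_right_iff nat_dvd_1_iff_1 not_less_iff_gr_or_eq plus_1_eq_Suc add.commute)
    have "toggle A \<notin> bad" if "A \<in> bad" for A
    proof (cases "w \<in> A")
      case True
      then have "insert w (A - {w}) = A" "A - {w} \<subseteq> U"
        using that by (auto simp: bad_def)
      then show ?thesis
        using insert_w[of "A - {w}"] not_both that True by (auto simp: bad_def toggle_def)
    next
      case False
      then show ?thesis
        using insert_w[of A] not_both that by (auto simp: bad_def toggle_def)
    qed
    then have "bad \<inter> toggle ` bad = {}"
      by auto
    moreover have "bad \<union> toggle ` bad \<subseteq> Pow U"
      using w(1) by (auto simp: bad_def toggle_def)
    moreover have "card (toggle ` bad) = card bad"
      by (rule card_image) (metis inj_onI toggle_toggle)
    moreover have "finite bad"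
      using U by (simp add: bad_def)
    ultimately have "2 * card bad \<le> card (Pow U)"
      using card_mono[of "Pow U" "bad \<union> toggle ` bad"] U by (simp add: card_Un_disjoint)
    then show ?thesis
      using U by (simp add: bad_def card_Pow)
  qed
  have "(\<Sum>A\<in>Pow U. card B) < (\<Sum>A\<in>Pow U. 2 * card {x \<in> B. p dvd card {u \<in> A. v x u}})"
    by (rule sum_strict_mono) (use U less in auto)
  also have "\<dots> = 2 * (\<Sum>x\<in>B. card {A \<in> Pow U. p dvd card {u \<in> A. v x u}})"
    using sum_multicount_gen[of "Pow U" B "\<lambda>A x. p dvd card {u \<in> A. v x u}"] U B
    by (simp add: sum_distrib_left[symmetric])
  also have "\<dots> \<le> (\<Sum>x\<in>B. 2 ^ card U)"
    unfolding sum_distrib_left by (rule sum_mono) (rule half)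
  finally show False
    using U by (simp add: card_Pow)
qed

text \<open>Each new set is chosen for the points missed so far and at least halves their number. It
  may coincide with an earlier one, hence only an upper bound on \<open>card F\<close>.\<close>

lemma exists_hitting_family:
  assumes U: "finite U" and B: "finite B" and p: "p > 1"
    and v: "\<And>x. x \<in> B \<Longrightarrow> \<exists>u\<in>U. v x u"
  shows "\<exists>F\<subseteq>Pow U. card F \<le> r \<and>
    2 ^ r * card {x \<in> B. \<forall>A\<in>F. p dvd card {u \<in> A. v x u}} \<le> card B"
proof (induction r)
  case 0
  then show ?case
    by (intro exI[of _ "{}"]) simp
next
  case (Suc r)
  then obtain F where F: "F \<subseteq> Pow U" "card F \<le> r"
      "2 ^ r * card {x \<in> B. \<forall>A\<in>F. p dvd card {u \<in> A. v x u}} \<le> card B"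
    by blast
  define B' where "B' = {x \<in> B. \<forall>A\<in>F. p dvd card {u \<in> A. v x u}}"
  obtain A where A: "A \<subseteq> U" "2 * card {x \<in> B'. p dvd card {u \<in> A. v x u}} \<le> card B'"
    using exists_hitting_set[OF U _ p, of B' v] B v by (auto simp: B'_def)
  have "{x \<in> B. \<forall>A\<in>insert A F. p dvd card {u \<in> A. v x u}}
      = {x \<in> B'. p dvd card {u \<in> A. v x u}}"
    by (auto simp: B'_def)
  then have "2 ^ Suc r * card {x \<in> B. \<forall>A\<in>insert A F. p dvd card {u \<in> A. v x u}}
      = 2 ^ r * (2 * card {x \<in> B'. p dvd card {u \<in> A. v x u}})"
    by simp
  also have "\<dots> \<le> 2 ^ r * card B'"
    using A(2) by (rule mult_le_mono2)
  also have "\<dots> \<le> card B"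
    using F(3) by (simp add: B'_def)
  finally show ?case
    using A(1) F(1,2) card_insert_le_m1[of "Suc r" F A]
    by (intro exI[of _ "insert A F"]) simp
qed

text \<open>By Fermat's little theorem, raising to the power \<open>p - 1\<close> turns the count
  into the indicator that it is nonzero modulo \<open>p\<close>.\<close>

lemma fermat_sum:
  assumes p: "prime p" and A: "finite A"
    and P: "\<And>u. u \<in> A \<Longrightarrow> [P u = of_bool (v u)] (mod int p)"
  shows "[(\<Sum>u\<in>A. P u) ^ (p - 1) = of_bool (\<not> p dvd card {u \<in> A. v u})] (mod int p)"
proof -
  define m where "m = card {u \<in> A. v u}"
  have "[(\<Sum>u\<in>A. P u) = (\<Sum>u\<in>A. of_bool (v u))] (mod int p)"
    using P by (rule cong_sum)
  also have "(\<Sum>u\<in>A. of_bool (v u)) = int m"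
    using A by (simp add: m_def sum.If_cases of_bool_def Int_def)
  finally have "[(\<Sum>u\<in>A. P u) ^ (p - 1) = int (m ^ (p - 1))] (mod int p)"
    using cong_pow by fastforce
  also have "[int (m ^ (p - 1)) = of_bool (\<not> p dvd m)] (mod int p)"
  proof (cases "p dvd m")
    case True
    moreover have "p - 1 > 0"
      using prime_gt_1_nat[OF p] by simp
    ultimately have "p dvd m ^ (p - 1)"
      by (metis dvd_power dvd_trans)
    then have "int p dvd int (m ^ (p - 1))"
      by (simp only: int_dvd_int_iff)
    with True show ?thesis
      by (simp add: cong_0_iff)
  next
    case False
    then have "[m ^ (p - 1) = 1] (mod p)"
      using fermat_theorem[OF p] by simp
    then have "[int (m ^ (p - 1)) = int 1] (mod int p)"
      by (simp only: cong_int_iff)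
    with False show ?thesis
      by simp
  qed
  finally show ?thesis
    by (simp add: m_def)
qed

definition computes_mod ::
    "nat \<Rightarrow> bool list set \<Rightarrow> (bool list \<Rightarrow> int) \<Rightarrow> (bool list \<Rightarrow> bool) \<Rightarrow> bool" where
  "computes_mod p Y f h \<longleftrightarrow> (\<forall>x\<in>Y. [f x = of_bool (h x)] (mod int p))"

text \<open>
  The set \<open>Y\<close> of good points is fixed before the representations \<open>P u\<close> of the inputs are given, so that
  the error sets of the gates of a circuit can be chosen independently of each other.
\<close>

definition approximable ::
    "nat \<Rightarrow> nat \<Rightarrow> bool list set \<Rightarrow> 'u set \<Rightarrow> (bool list \<Rightarrow> 'u \<Rightarrow> bool) \<Rightarrow> (bool list \<Rightarrow> bool) \<Rightarrow> bool" where
  "approximable p t Y U v h \<longleftrightarrow>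
    (\<forall>P w Z. Z \<subseteq> Y \<longrightarrow> (\<forall>u\<in>U. degree_le w (P u) \<and> computes_mod p Z (P u) (\<lambda>x. v x u)) \<longrightarrow>
      (\<exists>q. degree_le (t * w) q \<and> computes_mod p Z q h))"

lemma approximable_mono:
  assumes "approximable p t Y U v h" "t \<le> t'"
  shows "approximable p t' Y U v h"
  unfolding approximable_def
proof (intro allI impI)
  fix P w Z
  assume "Z \<subseteq> Y" "\<forall>u\<in>U. degree_le w (P u) \<and> computes_mod p Z (P u) (\<lambda>x. v x u)"
  then obtain q where "degree_le (t * w) q" "computes_mod p Z q h"
    using assms(1) unfolding approximable_def by blast
  then show "\<exists>q. degree_le (t' * w) q \<and> computes_mod p Z q h"
    using assms(2) degree_le_mono by (meson mult_le_mono1)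
qed

lemma computes_mod_not:
  assumes "computes_mod p Y f h"
  shows "computes_mod p Y (\<lambda>x. 1 - f x) (\<lambda>x. \<not> h x)"
  unfolding computes_mod_def
proof
  fix x assume "x \<in> Y"
  then have "[1 - f x = 1 - of_bool (h x)] (mod int p)"
    using assms by (intro cong_diff) (simp_all add: computes_mod_def)
  then show "[1 - f x = of_bool (\<not> h x)] (mod int p)"
    by (cases "h x") simp_all
qed

lemma approximable_not_output:
  assumes "approximable p t Y U v h"
  shows "approximable p t Y U v (\<lambda>x. \<not> h x)"
  unfolding approximable_def
proof (intro allI impI)
  fix P w Z
  assume "Z \<subseteq> Y" "\<forall>u\<in>U. degree_le w (P u) \<and> computes_mod p Z (P u) (\<lambda>x. v x u)"
  then obtain q where "degree_le (t * w) q" "computes_mod p Z q h"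
    using assms(1) unfolding approximable_def by blast
  then show "\<exists>q. degree_le (t * w) q \<and> computes_mod p Z q (\<lambda>x. \<not> h x)"
    using computes_mod_not degree_le_diff[OF degree_le_const] by blast
qed

text \<open>Passing from \<open>P u\<close> to \<open>1 - P u\<close> does not raise the degree
  bound. Together with negated outputs this gives De Morgan's law, which reduces AND to OR.\<close>

lemma approximable_not_inputs:
  assumes "approximable p t Y U (\<lambda>x u. \<not> v x u) h"
  shows "approximable p t Y U v h"
  unfolding approximable_def
proof (intro allI impI)
  fix P w Z
  assume "Z \<subseteq> Y" "\<forall>u\<in>U. degree_le w (P u) \<and> computes_mod p Z (P u) (\<lambda>x. v x u)"
  then have "Z \<subseteq> Y" "\<forall>u\<in>U. degree_le w (\<lambda>x. 1 - P u x) \<and>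
      computes_mod p Z (\<lambda>x. 1 - P u x) (\<lambda>x. \<not> v x u)"
    using computes_mod_not degree_le_diff[OF degree_le_const] by blast+
  then show "\<exists>q. degree_le (t * w) q \<and> computes_mod p Z q h"
    using assms(1)[unfolded approximable_def, rule_format, of Z w "\<lambda>u x. 1 - P u x"] by blast
qed

lemma approximable_mod:
  assumes "prime p" "finite U"
  shows "approximable p (p - 1) Y U v (\<lambda>x. \<not> p dvd card {u \<in> U. v x u})"
  unfolding approximable_def
proof (intro allI impI)
  fix P w Z
  assume P: "\<forall>u\<in>U. degree_le w (P u) \<and> computes_mod p Z (P u) (\<lambda>x. v x u)"
  show "\<exists>q. degree_le ((p - 1) * w) q \<and>
      computes_mod p Z q (\<lambda>x. \<not> p dvd card {u \<in> U. v x u})"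
  proof (intro exI conjI)
    show "degree_le ((p - 1) * w) (\<lambda>x. (\<Sum>u\<in>U. P u x) ^ (p - 1))"
      using P by (intro degree_le_power degree_le_sum) blast
    show "computes_mod p Z (\<lambda>x. (\<Sum>u\<in>U. P u x) ^ (p - 1))
        (\<lambda>x. \<not> p dvd card {u \<in> U. v x u})"
      unfolding computes_mod_def
      using P by (intro ballI fermat_sum assms) (simp add: computes_mod_def)
  qed
qed

text \<open>The polynomial is one minus the product over a hitting family \<open>F\<close> of the
  negated counting indicators. If all inputs are false, every factor is 1 and the value is right; if
  some input is true, a factor vanishes unless no set of \<open>F\<close> hits, and those points
  form \<open>E\<close>.\<close>

lemma approximable_or:
  assumes p: "prime p" and U: "finite U" and X: "finite X"
  shows "\<exists>E\<subseteq>X. 2 ^ r * card E \<le> card X \<and>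
    approximable p (r * (p - 1)) (X - E) U v (\<lambda>x. \<exists>u\<in>U. v x u)"
proof -
  define B where "B = {x \<in> X. \<exists>u\<in>U. v x u}"
  have "card B \<le> card X"
    using X by (auto simp: B_def intro: card_mono)
  have "\<exists>F\<subseteq>Pow U. card F \<le> r \<and>
      2 ^ r * card {x \<in> B. \<forall>A\<in>F. p dvd card {u \<in> A. v x u}} \<le> card B"
    by (rule exists_hitting_family[OF U _ prime_gt_1_nat[OF p]]) (simp_all add: B_def X)
  then obtain F where F: "F \<subseteq> Pow U" "card F \<le> r"
      "2 ^ r * card {x \<in> B. \<forall>A\<in>F. p dvd card {u \<in> A. v x u}} \<le> card B"
    by blast
  define E where "E = {x \<in> B. \<forall>A\<in>F. p dvd card {u \<in> A. v x u}}"
  have "finite F"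
    using F(1) U by (metis finite_Pow_iff finite_subset)
  have "approximable p (r * (p - 1)) (X - E) U v (\<lambda>x. \<exists>u\<in>U. v x u)"
    unfolding approximable_def
  proof (intro allI impI)
    fix P w Z
    assume Z: "Z \<subseteq> X - E"
      and P: "\<forall>u\<in>U. degree_le w (P u) \<and> computes_mod p Z (P u) (\<lambda>x. v x u)"
    define q where "q x = 1 - (\<Prod>A\<in>F. 1 - (\<Sum>u\<in>A. P u x) ^ (p - 1))" for x
    have "degree_le (card F * ((p - 1) * w)) q"
      unfolding q_def using P F(1)
      by (intro degree_le_diff degree_le_const degree_le_prod degree_le_power degree_le_sum) blast
    moreover have "card F * ((p - 1) * w) \<le> r * (p - 1) * w"
      using F(2) by (simp add: mult.assoc)
    ultimately have "degree_le (r * (p - 1) * w) q"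
      by (rule degree_le_mono)
    moreover have "computes_mod p Z q (\<lambda>x. \<exists>u\<in>U. v x u)"
      unfolding computes_mod_def
    proof
      fix x assume x: "x \<in> Z"
      have "[(\<Sum>u\<in>A. P u x) ^ (p - 1) = of_bool (\<not> p dvd card {u \<in> A. v x u})] (mod int p)"
        if "A \<in> F" for A
      proof (rule fermat_sum[OF p])
        have "A \<subseteq> U"
          using F(1) that by blast
        then show "finite A"
          using U finite_subset by blast
        fix u assume "u \<in> A"
        then show "[P u x = of_bool (v x u)] (mod int p)"
          using \<open>A \<subseteq> U\<close> P x unfolding computes_mod_def by blast
      qed
      then have "[q x = 1 - (\<Prod>A\<in>F. 1 - of_bool (\<not> p dvd card {u \<in> A. v x u}))] (mod int p)"
        unfolding q_def by (intro cong_diff cong_prod cong_refl)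
      moreover have "1 - (\<Prod>A\<in>F. 1 - of_bool (\<not> p dvd card {u \<in> A. v x u})) =
          (of_bool (\<exists>u\<in>U. v x u) :: int)"
      proof (cases "\<exists>u\<in>U. v x u")
        case True
        then obtain A where "A \<in> F" "\<not> p dvd card {u \<in> A. v x u}"
          using x Z by (auto simp: E_def B_def)
        then have "(\<Prod>A\<in>F. 1 - of_bool (\<not> p dvd card {u \<in> A. v x u})) = (0 :: int)"
          using \<open>finite F\<close> by (intro prod_zero) auto
        with True show ?thesis
          by simp
      next
        case False
        have "p dvd card {u \<in> A. v x u}" if "A \<in> F" for A
        proof -
          have "{u \<in> A. v x u} = {}"
            using that F(1) False by blast
          then show ?thesis
            by (simp only: card.empty dvd_0_right)
        qed
        then have "(\<Prod>A\<in>F. 1 - of_bool (\<not> p dvd card {u \<in> A. v x u})) = (\<Prod>A\<in>F. 1 :: int)"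
          by (intro prod.cong) simp_all
        with False show ?thesis
          by simp
      qed
      ultimately show "[q x = of_bool (\<exists>u\<in>U. v x u)] (mod int p)"
        by simp
    qed
    ultimately show "\<exists>q. degree_le (r * (p - 1) * w) q \<and> computes_mod p Z q (\<lambda>x. \<exists>u\<in>U. v x u)"
      by blast
  qed
  moreover have "E \<subseteq> X" "2 ^ r * card E \<le> card X"
    using F(3) \<open>card B \<le> card X\<close> by (auto simp: E_def B_def)
  ultimately show ?thesis
    by blast
qed

text \<open>NOT and MOD gates are represented without error; \<open>r \<ge> 1\<close> lets them
  share the degree factor of OR gates.\<close>

lemma approximable_gate:
  assumes p: "prime p" and g: "finite (gate_inputs g)" and X: "finite X" and r: "r \<ge> 1"
  shows "\<exists>E\<subseteq>X. 2 ^ r * card E \<le> card X \<and>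
    approximable p (r * (p - 1)) (X - E) (gate_inputs g) v (\<lambda>x. gate_value p (v x) g)"
proof (cases g)
  case (Not_Gate u)
  have "approximable p 1 X {u} v (\<lambda>x. v x u)"
    by (auto simp: approximable_def)
  then have "approximable p 1 X {u} v (\<lambda>x. \<not> v x u)"
    by (rule approximable_not_output)
  moreover have "1 \<le> r * (p - 1)"
    using r prime_gt_1_nat[OF p] by simp
  ultimately have "approximable p (r * (p - 1)) X {u} v (\<lambda>x. \<not> v x u)"
    by (rule approximable_mono)
  then show ?thesis
    unfolding Not_Gate by (intro exI[of _ "{}"]) simp
next
  case (And_Gate U)
  then obtain E where E: "E \<subseteq> X" "2 ^ r * card E \<le> card X"
      "approximable p (r * (p - 1)) (X - E) U (\<lambda>x u. \<not> v x u) (\<lambda>x. \<exists>u\<in>U. \<not> v x u)"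
    using approximable_or[OF p _ X, of U r "\<lambda>x u. \<not> v x u"] g by auto
  from E(3) have "approximable p (r * (p - 1)) (X - E) U v (\<lambda>x. \<not> (\<exists>u\<in>U. \<not> v x u))"
    by (rule approximable_not_output[OF approximable_not_inputs])
  then show ?thesis
    unfolding And_Gate using E(1,2) by (intro exI[of _ E]) simp
next
  case (Or_Gate U)
  then show ?thesis
    using approximable_or[OF p _ X, of U r v] g by simp
next
  case (Mod_Gate U)
  then have "approximable p (p - 1) X U v (\<lambda>x. \<not> p dvd card {u \<in> U. v x u})"
    using approximable_mod[OF p] g by simp
  moreover have "p - 1 \<le> r * (p - 1)"
    using r by simp
  ultimately have "approximable p (r * (p - 1)) X U v (\<lambda>x. \<not> p dvd card {u \<in> U. v x u})"
    by (rule approximable_mono)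
  then show ?thesis
    unfolding Mod_Gate by (intro exI[of _ "{}"]) simp
qed

section \<open>Approximation of circuits\<close>

lemma gate_values_snoc:
  "gate_values p x (gs @ [g]) = gate_values p x gs @ [gate_value p (node_value x (gate_values p x gs)) g]"
  by (simp add: gate_values_def)

lemma length_gate_values [simp]: "length (gate_values p x gs) = length gs"
  by (induction gs rule: rev_induct) (simp_all add: gate_values_snoc, simp add: gate_values_def)

lemma gate_values_append_nth:
  "i < length gs \<Longrightarrow> gate_values p x (gs @ hs) ! i = gate_values p x gs ! i"
  by (induction hs rule: rev_induct)
    (simp_all add: gate_values_snoc nth_append flip: append_assoc)

lemma gate_value_cong:
  assumes "\<And>u. u \<in> gate_inputs g \<Longrightarrow> v u = v' u"
  shows "gate_value p v g = gate_value p v' g"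
proof (cases g)
  case (Mod_Gate U)
  with assms have "{u \<in> U. v u} = {u \<in> U. v' u}"
    by auto
  with Mod_Gate show ?thesis
    by simp
qed (use assms in auto)

definition node_val :: "nat \<Rightarrow> circuit \<Rightarrow> bool list \<Rightarrow> node \<Rightarrow> bool" where
  "node_val p C x = node_value x (gate_values p x (gates C))"

lemma node_val_Input [simp]: "node_val p C x (Input i) = x ! i"
  by (simp add: node_val_def)

lemma circuit_value_eq: "circuit_value p C x = node_val p C x (out_node C)"
  by (simp add: circuit_value_def node_val_def)

lemma gate_inputs_subset:
  assumes "circuit_on n C" "i < length (gates C)"
  shows "gate_inputs (gates C ! i) \<subseteq> Input ` {..<n} \<union> Gate ` {..<i}"
  using assms by (simp add: circuit_on_def)

text \<open>A gate reads only earlier positions, whose values no longer change when the list of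
  gates is extended. This replaces sequential evaluation by a recursion on the graph.\<close>

lemma node_val_Gate:
  assumes C: "circuit_on n C" and i: "i < length (gates C)"
  shows "node_val p C x (Gate i) = gate_value p (node_val p C x) (gates C ! i)"
proof -
  let ?gs = "take i (gates C)" and ?g = "gates C ! i"
  have split: "gates C = (?gs @ [?g]) @ drop (Suc i) (gates C)"
    using i by (simp add: id_take_nth_drop[symmetric])
  have "node_val p C x (Gate i) = gate_values p x (?gs @ [?g]) ! i"
    using i gate_values_append_nth[of i "?gs @ [?g]" p x "drop (Suc i) (gates C)"] split
    by (simp add: node_val_def)
  also have "\<dots> = gate_value p (node_value x (gate_values p x ?gs)) ?g"
    using i by (simp add: gate_values_snoc nth_append)
  also have "\<dots> = gate_value p (node_val p C x) ?g"
  proof (rule gate_value_cong)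
    fix u assume "u \<in> gate_inputs ?g"
    then consider j where "u = Input j" | j where "u = Gate j" "j < i"
      using gate_inputs_subset[OF C i] by auto
    then show "node_value x (gate_values p x ?gs) u = node_val p C x u"
    proof cases
      case (2 j)
      then show ?thesis
        using i gate_values_append_nth[of j ?gs p x "drop i (gates C)"]
        by (simp add: node_val_def)
    qed simp
  qed
  finally show ?thesis .
qed

section \<open>Longest paths and the growth of degrees along the circuit\<close>

definition path_lengths :: "circuit \<Rightarrow> node \<Rightarrow> nat set" where
  "path_lengths C u = {k. \<exists>i. (Input i, u) \<in> edges C ^^ k}"

lemma path_lengths_Input [simp]: "path_lengths C (Input j) = {0}"
proof (intro equalityI subsetI)
  fix k assume "k \<in> path_lengths C (Input j)"
  then show "k \<in> {0}"
    by (cases k) (auto simp: path_lengths_def edges_def)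
qed (auto simp: path_lengths_def)

lemma path_lengths_Gate:
  "k \<in> path_lengths C (Gate j) \<longleftrightarrow>
    (\<exists>l. k = Suc l \<and> j < length (gates C) \<and> (\<exists>u\<in>gate_inputs (gates C ! j). l \<in> path_lengths C u))"
  by (cases k) (auto simp: path_lengths_def edges_def relcomp_unfold)

text \<open>Gates along a path have increasing positions. The resulting finiteness makes the
  supremum in the depth a true maximum.\<close>

lemma path_length_le:
  assumes "circuit_on n C" "k \<in> path_lengths C (Gate j)"
  shows "k \<le> Suc j"
  using assms(2)
proof (induction j arbitrary: k rule: less_induct)
  case (less j)
  then obtain l u where l: "k = Suc l" "j < length (gates C)" "u \<in> gate_inputs (gates C ! j)"
      "l \<in> path_lengths C u"
    by (auto simp: path_lengths_Gate)
  then consider i where "u = Input i" | i where "u = Gate i" "i < j"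
    using gate_inputs_subset[OF assms(1) l(2)] by auto
  then show ?case
  proof cases
    case (2 i)
    then show ?thesis
      using less.IH[of i l] l by simp
  qed (use l in simp)
qed

lemma finite_path_lengths:
  assumes "circuit_on n C"
  shows "finite (path_lengths C u)"
proof (cases u)
  case (Gate j)
  then have "path_lengths C u \<subseteq> {..Suc j}"
    using path_length_le[OF assms] by auto
  then show ?thesis
    using finite_subset by blast
qed simp

text \<open>
  Nodes that are not reachable from an input variable compute constants, so they may have any
  height in the circuit without contributing to its depth.
\<close>

definition weight :: "nat \<Rightarrow> circuit \<Rightarrow> node \<Rightarrow> nat" where
  "weight t C u = (if path_lengths C u = {} then 0 else t ^ Sup (path_lengths C u))"

text \<open>Here \<open>w\<close> is a common degree bound for the inputs of the gate. If the
  longest path to the gate has length \<open>Suc l\<close>, those to its inputs have length at most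
  \<open>l\<close>, so \<open>t ^ l\<close> serves; if there is no path, its inputs have none
  either, and 0 serves.\<close>

lemma weight_Gate:
  assumes C: "circuit_on n C" and j: "j < length (gates C)" and t: "t \<ge> 1"
  shows "\<exists>w. t * w \<le> weight t C (Gate j) \<and> (\<forall>u\<in>gate_inputs (gates C ! j). weight t C u \<le> w)"
proof (cases "path_lengths C (Gate j) = {}")
  case True
  then have "path_lengths C u = {}" if "u \<in> gate_inputs (gates C ! j)" for u
    using that j path_lengths_Gate by blast
  then show ?thesis
    by (intro exI[of _ 0]) (simp add: weight_def)
next
  case False
  let ?m = "Max (path_lengths C (Gate j))"
  have fin: "finite (path_lengths C u)" for u
    using finite_path_lengths[OF C] .
  have "?m \<in> path_lengths C (Gate j)"
    using False fin by simp
  then obtain l where l: "?m = Suc l"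
    by (auto simp: path_lengths_Gate)
  show ?thesis
  proof (intro exI conjI ballI)
    show "t * t ^ l \<le> weight t C (Gate j)"
      using False l by (simp add: weight_def Sup_nat_def)
    fix u assume u: "u \<in> gate_inputs (gates C ! j)"
    have "Max (path_lengths C u) \<le> l" if "path_lengths C u \<noteq> {}"
    proof -
      have "Suc (Max (path_lengths C u)) \<in> path_lengths C (Gate j)"
        unfolding path_lengths_Gate using j u Max_in[OF fin that] by blast
      then have "Suc (Max (path_lengths C u)) \<le> ?m"
        using fin by simp
      with l show ?thesis
        by simp
    qed
    then show "weight t C u \<le> t ^ l"
      using t by (simp add: weight_def Sup_nat_def power_increasing)
  qed
qed

text \<open>Every gate first receives an error set with respect to the true values of its inputs,
  and a union bound controls the union \<open>D\<close>. Off \<open>D\<close> the polynomials are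
  then composed in topological order, with \<open>weight\<close> bounding their degrees.\<close>

lemma circuit_approximation:
  assumes p: "prime p" and C: "circuit_on n C" and r: "r \<ge> 1"
  shows "\<exists>E q. E \<subseteq> cube n \<and> 2 ^ r * card E \<le> num_gates C * 2 ^ n \<and>
    degree_le ((r * (p - 1)) ^ depth C) q \<and> computes_mod p (cube n - E) q (circuit_value p C)"
proof -
  define t where "t = r * (p - 1)"
  have t: "t \<ge> 1"
    using r prime_gt_1_nat[OF p] by (simp add: t_def)
  let ?s = "length (gates C)" and ?v = "node_val p C"
  have "\<exists>E\<subseteq>cube n. 2 ^ r * card E \<le> 2 ^ n \<and>
      approximable p t (cube n - E) (gate_inputs (gates C ! i)) ?v (\<lambda>x. ?v x (Gate i))"
    if i: "i < ?s" for i
  proof -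
    have "finite (gate_inputs (gates C ! i))"
      using gate_inputs_subset[OF C i] by (rule finite_subset) simp
    from approximable_gate[OF p this finite_cube r, of n ?v] show ?thesis
      by (simp add: t_def node_val_Gate[OF C i])
  qed
  then obtain E where E: "\<And>i. i < ?s \<Longrightarrow> E i \<subseteq> cube n" "\<And>i. i < ?s \<Longrightarrow> 2 ^ r * card (E i) \<le> 2 ^ n"
      "\<And>i. i < ?s \<Longrightarrow> approximable p t (cube n - E i) (gate_inputs (gates C ! i)) ?v (\<lambda>x. ?v x (Gate i))"
    by metis
  define D where "D = (\<Union>i<?s. E i)"
  define good where "good u \<longleftrightarrow>
    (\<exists>q. degree_le (weight t C u) q \<and> computes_mod p (cube n - D) q (\<lambda>x. ?v x u))" for u
  have good_Input: "good (Input i)" for i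
  proof -
    have "degree_le 1 (\<lambda>x. of_bool (x ! i))"
      using degree_le_nth_prod[of "{i}" "\<lambda>_. of_bool"] by simp
    then show ?thesis
      unfolding good_def
      by (intro exI[of _ "\<lambda>x. of_bool (x ! i)"]) (simp add: weight_def computes_mod_def)
  qed
  have good_Gate: "good (Gate i)" if "i < ?s" for i
    using that
  proof (induction i rule: less_induct)
    case (less i)
    have "good u" if "u \<in> gate_inputs (gates C ! i)" for u
      using that gate_inputs_subset[OF C less.prems] less good_Input by fastforce
    then obtain P where P: "\<And>u. u \<in> gate_inputs (gates C ! i) \<Longrightarrow> degree_le (weight t C u) (P u)"
        "\<And>u. u \<in> gate_inputs (gates C ! i) \<Longrightarrow> computes_mod p (cube n - D) (P u) (\<lambda>x. ?v x u)"
      unfolding good_def by metis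
    obtain w where w: "t * w \<le> weight t C (Gate i)"
        "\<And>u. u \<in> gate_inputs (gates C ! i) \<Longrightarrow> weight t C u \<le> w"
      using weight_Gate[OF C less.prems t] by blast
    have "cube n - D \<subseteq> cube n - E i"
      using less.prems by (auto simp: D_def)
    moreover have "\<forall>u\<in>gate_inputs (gates C ! i).
        degree_le w (P u) \<and> computes_mod p (cube n - D) (P u) (\<lambda>x. ?v x u)"
      using P w(2) degree_le_mono by blast
    ultimately obtain q where "degree_le (t * w) q" "computes_mod p (cube n - D) q (\<lambda>x. ?v x (Gate i))"
      using E(3)[OF less.prems] unfolding approximable_def by blast
    then show ?case
      unfolding good_def using w(1) degree_le_mono by blast
  qed
  have "out_node C \<in> Input ` {..<n} \<union> Gate ` {..<?s}"
    using C by (simp add: circuit_on_def)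
  then have "good (out_node C)"
    using good_Input good_Gate by auto
  then obtain q where q: "degree_le (weight t C (out_node C)) q"
      "computes_mod p (cube n - D) q (circuit_value p C)"
    by (auto simp: good_def circuit_value_eq[abs_def])
  have "weight t C (out_node C) \<le> t ^ depth C"
    by (simp add: weight_def depth_def path_lengths_def)
  then have "degree_le (t ^ depth C) q"
    using q(1) degree_le_mono by blast
  moreover have "D \<subseteq> cube n"
    using E(1) by (auto simp: D_def)
  moreover have "2 ^ r * card D \<le> num_gates C * 2 ^ n"
  proof -
    have "card D \<le> (\<Sum>i<?s. card (E i))"
      unfolding D_def by (rule card_UN_le) simp
    then have "2 ^ r * card D \<le> (\<Sum>i<?s. 2 ^ r * card (E i))"
      by (simp add: sum_distrib_left[symmetric])
    also have "\<dots> \<le> (\<Sum>i<?s. 2 ^ n)"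
      by (rule sum_mono) (use E(2) in simp)
    finally show ?thesis
      by (simp add: num_gates_def)
  qed
  ultimately show ?thesis
    using q(2) unfolding t_def by blast
qed

text \<open>An input variable as output would give depth 0. In particular a circuit of positive
  depth has at least one gate.\<close>

lemma out_node_is_gate:
  assumes "circuit_on n C" "depth C \<ge> 1"
  obtains j where "j < num_gates C" "out_node C = Gate j"
proof (cases "out_node C")
  case (Input j)
  then have "depth C = 0"
    using path_lengths_Input[of C j] by (simp add: depth_def path_lengths_def)
  with assms(2) show ?thesis
    by simp
next
  case (Gate j)
  with assms(1) that show ?thesis
    by (auto simp: circuit_on_def num_gates_def)
qed

text \<open>Flipping an unread variable of an accepted point would yield an accepted even point, so
  the gate reads all variables unless nothing is accepted. Having \<open>n \<ge> 2\<close> inputs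
  excludes NOT, an even point with two ones excludes OR and MOD, and AND accepts one point
  only.\<close>

lemma single_gate_bound:
  assumes p: "prime p" "odd p" and C: "circuit_on n C" "depth C \<ge> 1" "num_gates C = 1" and n: "n \<ge> 2"
    and sub: "{x \<in> cube n. circuit_value p C x} \<subseteq> {x \<in> cube n. parity x}"
  shows "card {x \<in> cube n. circuit_value p C x} \<le> 1"
proof (cases "{x \<in> cube n. circuit_value p C x} = {}")
  case False
  then obtain x where x: "x \<in> cube n" "circuit_value p C x" "parity x"
    using sub by auto
  define g where "g = gates C ! 0"
  have out: "out_node C = Gate 0"
    using out_node_is_gate[OF C(1,2)] C(3) by auto
  have pos: "0 < length (gates C)"
    using C(3) by (simp add: num_gates_def)
  have val: "circuit_value p C z = gate_value p (node_val p C z) g" for z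
    using node_val_Gate[OF C(1) pos] by (simp add: circuit_value_eq g_def out)
  have g_sub: "gate_inputs g \<subseteq> Input ` {..<n}"
    using gate_inputs_subset[OF C(1) pos] by (simp add: g_def)
  have "Input i \<in> gate_inputs g" if i: "i < n" for i
  proof (rule ccontr)
    assume "Input i \<notin> gate_inputs g"
    have "node_val p C (flip i x) u = node_val p C x u" if u: "u \<in> gate_inputs g" for u
    proof -
      obtain j where "u = Input j" "j \<noteq> i"
        using u g_sub \<open>Input i \<notin> gate_inputs g\<close> by blast
      then show ?thesis
        by simp
    qed
    then have "flip i x \<in> {x \<in> cube n. circuit_value p C x}"
      using gate_value_cong[of g "node_val p C (flip i x)" "node_val p C x"] x by (simp add: val)
    then have "parity (flip i x)"
      using sub by blast
    then show False
      using parity_flip[of i x] i x by (simp add: cube_def)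
  qed
  then have g: "gate_inputs g = Input ` {..<n}"
    using g_sub by auto
  \<comment> \<open>Exactly two ones: an even number that is not divisible by the odd prime
    \<open>p\<close>.\<close>
  define z where "z = map (\<lambda>i. i < 2) [0..<n]"
  have z_inputs: "{u \<in> Input ` {..<n}. node_val p C z u} = {Input 0, Input 1}"
    using n by (auto simp: z_def)
  have "z \<in> cube n"
    by (simp add: z_def cube_def)
  moreover have "{i. i < length z \<and> z ! i} = {0, 1}"
    using n by (auto simp: z_def)
  then have "\<not> parity z"
    by (simp add: parity_conv_card)
  ultimately have not_z: "\<not> gate_value p (node_val p C z) g"
    using sub by (auto simp: val)
  show ?thesis
  proof (cases g)
    case (Not_Gate u)
    then have "Input 0 = u" "Input 1 = u"
      using g n by auto
    then show ?thesis
      by auto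
  next
    case (And_Gate U)
    have "y = replicate n True" if "y \<in> cube n" "circuit_value p C y" for y
    proof -
      have "\<forall>u\<in>U. node_val p C y u"
        using that(2) And_Gate by (simp add: val)
      then have "y ! i" if "i < n" for i
        using that g And_Gate by auto
      then show ?thesis
        using that(1) by (simp add: cube_def list_eq_iff_nth_eq)
    qed
    then have "{x \<in> cube n. circuit_value p C x} \<subseteq> {replicate n True}"
      by auto
    then show ?thesis
      using card_mono[of "{replicate n True}"] by simp
  next
    case (Or_Gate U)
    then have "Input 0 \<in> U" "node_val p C z (Input 0)"
      using g n by (auto simp: z_def)
    then have "gate_value p (node_val p C z) g"
      unfolding Or_Gate gate_value.simps by blast
    with not_z show ?thesis
      by contradiction
  next
    case (Mod_Gate U)
    then have "U = Input ` {..<n}"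
      using g by simp
    then have "{u \<in> U. node_val p C z u} = {Input 0, Input 1}"
      by (simp only: z_inputs)
    then have "p dvd 2"
      using not_z Mod_Gate by (simp add: numeral_2_eq_2)
    then have "p \<le> 2"
      by (rule dvd_imp_le) simp
    with prime_gt_1_nat[OF p(1)] p(2) show ?thesis
      by (cases "p = 2") auto
  qed
qed (simp only: card.empty le0)

section \<open>Binomial estimates\<close>

text \<open>Consecutive central binomials have ratio \<open>2 * (2 * m + 1) / (m + 1)\<close>, and
  \<open>(2 * m + 1) * (2 * m + 3)\<close> is at most \<open>4 * (m + 1)^2\<close>.\<close>

lemma central_binomial_upper:
  "(2 * m choose m)\<^sup>2 * (2 * m + 1) \<le> 16 ^ m"
proof (induction m)
  case (Suc m)
  define c where "c = (2 * m choose m)"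
  define c' where "c' = (2 * Suc m choose Suc m)"
  have "Suc m * (Suc (2 * m) choose m) = Suc (2 * m) * c"
    using Suc_times_binomial[of m "2 * m"] binomial_symmetric[of m "Suc (2 * m)"]
    by (simp add: c_def)
  moreover have "Suc m * c' = 2 * Suc m * (Suc (2 * m) choose m)"
    using Suc_times_binomial[of m "Suc (2 * m)"] by (simp add: c'_def)
  ultimately have step: "Suc m * c' = 2 * Suc (2 * m) * c"
    by (simp add: algebra_simps)
  have "(Suc m)\<^sup>2 * (c'\<^sup>2 * (2 * Suc m + 1))
      = (Suc m * c')\<^sup>2 * (2 * m + 3)"
    by (simp add: power2_eq_square algebra_simps)
  also have "\<dots> = (c\<^sup>2 * (2 * m + 1)) * (4 * (2 * m + 1) * (2 * m + 3))"
    unfolding step by (simp add: power2_eq_square algebra_simps)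
  also have "\<dots> \<le> 16 ^ m * (16 * (Suc m)\<^sup>2)"
    by (rule mult_le_mono[OF Suc.IH[folded c_def]]) (simp add: power2_eq_square algebra_simps)
  also have "\<dots> = (Suc m)\<^sup>2 * 16 ^ Suc m"
    by simp
  finally have "c'\<^sup>2 * (2 * Suc m + 1) \<le> 16 ^ Suc m"
    by (rule mult_left_le_imp_le) simp
  then show ?case
    by (simp only: c'_def)
qed simp

lemma middle_binomial_upper: "(n choose (n div 2))\<^sup>2 * n \<le> 4 ^ n"
proof (cases "even n")
  case True
  then obtain m where n: "n = 2 * m"
    by blast
  have "(n choose (n div 2))\<^sup>2 * n \<le> (2 * m choose m)\<^sup>2 * (2 * m + 1)"
    unfolding n by (intro mult_mono) simp_all
  also have "\<dots> \<le> 16 ^ m"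
    by (rule central_binomial_upper)
  also have "\<dots> = 4 ^ n"
    by (simp add: n power_mult)
  finally show ?thesis .
next
  case False
  then obtain m where n: "n = 2 * m + 1"
    by (blast elim: oddE)
  \<comment> \<open>For odd \<open>n\<close> the middle binomial is half of the next central one, by
    Pascal's rule and symmetry.\<close>
  have "2 * (n choose m) = (2 * Suc m choose Suc m)"
    using binomial_symmetric[of m n] n by simp
  have "4 * ((n choose m)\<^sup>2 * n) = (2 * (n choose m))\<^sup>2 * n"
    by (simp add: power2_eq_square)
  also have "\<dots> = (2 * Suc m choose Suc m)\<^sup>2 * n"
    by (simp only: \<open>2 * (n choose m) = _\<close>)
  also have "\<dots> \<le> (2 * Suc m choose Suc m)\<^sup>2 * (2 * Suc m + 1)"
    by (intro mult_mono) (simp_all add: n)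
  also have "\<dots> \<le> 16 ^ Suc m"
    by (rule central_binomial_upper)
  also have "\<dots> = 4 * 4 ^ n"
    by (simp add: n power_mult)
  finally show ?thesis
    by (simp add: n)
qed

text \<open>At most \<open>2 * m + 1\<close> layers lie strictly between \<open>k\<close> and
  \<open>n - k\<close>, each of size at most \<open>2 ^ n / sqrt n\<close>. The hypothesis makes
  them at most half of the cube, and the two symmetric tails share the rest.\<close>

lemma sum_binomial_lower:
  assumes m: "16 * (m + 1)\<^sup>2 \<le> n"
  shows "\<exists>k. 2 * (m + k) < n \<and> 2 ^ n \<le> 4 * (\<Sum>i\<le>k. n choose i)"
proof -
  \<comment> \<open>The largest \<open>k\<close> with \<open>2 * (m + k) < n\<close>.\<close>
  define k where "k = (n - 1) div 2 - m"
  have "16 * (m + 1) \<le> n"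
    using m by (simp add: power2_eq_square)
  then have k: "2 * (m + k) < n" "n - k - k \<le> 2 * m + 2"
    by (auto simp: k_def)
  define c where "c = (n choose (n div 2))"
  have "{..n} = {..k} \<union> {k<..<n - k} \<union> {n - k..n}"
    using k by auto
  then have "(\<Sum>i\<le>n. n choose i) = (\<Sum>i\<in>{..k} \<union> {k<..<n - k} \<union> {n - k..n}. n choose i)"
    by simp
  also have "\<dots> = (\<Sum>i\<le>k. n choose i) + (\<Sum>i\<in>{k<..<n - k}. n choose i) + (\<Sum>i=n - k..n. n choose i)"
    using k by (subst sum.union_disjoint sum.union_disjoint; auto)+
  also have "(\<Sum>i=n - k..n. n choose i) = (\<Sum>i\<le>k. n choose i)"
    using k
    by (intro sum.reindex_bij_witness[of _ "\<lambda>i. n - i" "\<lambda>i. n - i"])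
      (auto simp: binomial_symmetric[symmetric])
  also have "(\<Sum>i\<in>{k<..<n - k}. n choose i) \<le> (\<Sum>i\<in>{k<..<n - k}. c)"
    by (rule sum_mono) (simp add: c_def binomial_maximum)
  also have "\<dots> = (n - k - Suc k) * c"
    by simp
  also have "\<dots> \<le> (2 * m + 1) * c"
    by (rule mult_le_mono1) (use k(2) in linarith)
  finally have "2 ^ n \<le> 2 * (\<Sum>i\<le>k. n choose i) + (2 * m + 1) * c"
    using choose_row_sum[of n] by simp
  moreover have "2 * ((2 * m + 1) * c) \<le> 2 ^ n"
  proof (rule power2_le_imp_le)
    have "(2 * ((2 * m + 1) * c))\<^sup>2 = c\<^sup>2 * (2 * (2 * m + 1))\<^sup>2"
      by (simp add: power2_eq_square algebra_simps)
    also have "\<dots> \<le> c\<^sup>2 * n"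
    proof (rule mult_le_mono2)
      have "(2 * (2 * m + 1))\<^sup>2 \<le> (4 * (m + 1))\<^sup>2"
        by (intro power_mono) simp_all
      also have "\<dots> = 16 * (m + 1)\<^sup>2"
        by (simp add: power2_eq_square algebra_simps)
      finally show "(2 * (2 * m + 1))\<^sup>2 \<le> n"
        using m by linarith
    qed
    also have "\<dots> \<le> 4 ^ n"
      unfolding c_def by (rule middle_binomial_upper)
    also have "\<dots> = (2 ^ n)\<^sup>2"
      by (simp add: power2_eq_square flip: power_mult_distrib)
    finally show "(2 * ((2 * m + 1) * c))\<^sup>2 \<le> (2 ^ n)\<^sup>2" .
  qed simp
  ultimately have "2 ^ n \<le> 4 * (\<Sum>i\<le>k. n choose i)"
    by linarith
  with k(1) show ?thesis
    by blast
qed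

text \<open>
  The exponent makes \<open>sqrt n = y ^ ((6 + p) * d)\<close>, where \<open>6 + p\<close> is such that
  \<open>24 * p * y \<le> y ^ (6 + p)\<close> for all \<open>y \<ge> 2\<close>.
\<close>

lemma degree_estimate:
  fixes p d n :: nat and y :: real
  assumes p: "p > 1" and d: "d \<ge> 1" and n: "n \<ge> 1"
    and y: "y = real n powr (1 / real (12 + 2 * p) / real d)" "y > 2"
  shows "16 * (((nat \<lceil>y\<rceil> + 2) * (p - 1)) ^ d + 1)\<^sup>2 \<le> n"
proof -
  define t where "t = (nat \<lceil>y\<rceil> + 2) * (p - 1)"
  have "real (nat \<lceil>y\<rceil> + 2) \<le> 3 * y"
    using y(2) by linarith
  then have "real t \<le> 3 * y * real p"
    unfolding t_def of_nat_mult using y(2) by (intro mult_mono) simp_all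
  have "t \<ge> 1"
    using p by (simp add: t_def)
  \<comment> \<open>The factor 4 is the root of the 16 in the goal; the resulting 8 is enlarged to
    \<open>8 ^ d\<close> and absorbed into the power.\<close>
  then have "4 * (real t ^ d + 1) \<le> 8 * real t ^ d"
    using one_le_power[of "real t" d] by simp
  also have "\<dots> \<le> 8 ^ d * (3 * y * real p) ^ d"
    using \<open>real t \<le> 3 * y * real p\<close> self_le_power[of "8 :: real" d] d
    by (intro mult_mono power_mono) simp_all
  also have "\<dots> = (24 * real p * y) ^ d"
    unfolding power_mult_distrib[symmetric] by (simp add: mult_ac)
  also have "\<dots> \<le> (y ^ (6 + p)) ^ d"
  proof (intro power_mono)
    have "real p \<le> 2 ^ p"
      using less_exp[of p] by (metis less_imp_le of_nat_le_iff of_nat_numeral of_nat_power)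
    then have "24 * real p \<le> 32 * 2 ^ p"
      by linarith
    also have "\<dots> = 2 ^ (5 + p)"
      by (simp add: power_add)
    also have "\<dots> \<le> y ^ (5 + p)"
      using y(2) by (intro power_mono) simp_all
    finally have "24 * real p * y \<le> y ^ (5 + p) * y"
      using y(2) by (intro mult_right_mono) simp_all
    also have "\<dots> = y ^ Suc (5 + p)"
      by (simp only: power_Suc2)
    also have "Suc (5 + p) = 6 + p"
      by simp
    finally show "24 * real p * y \<le> y ^ (6 + p)" .
  qed (use y(2) in simp)
  also have "\<dots> = y powr real ((6 + p) * d)"
    using y(2) by (simp add: powr_realpow power_mult[symmetric] del: of_nat_mult of_nat_add)
  also have "\<dots> = real n powr (1 / 2)"
  proof -
    have "1 / real (12 + 2 * p) / real d * real ((6 + p) * d) = 1 / 2"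
      using d by (simp add: divide_simps)
    then show ?thesis
      unfolding y(1) powr_powr by (rule arg_cong)
  qed
  finally have "(4 * (real t ^ d + 1))\<^sup>2 \<le> (real n powr (1 / 2))\<^sup>2"
    by (rule power_mono) simp
  also have "\<dots> = real n"
    using n by (simp add: powr_half_sqrt)
  finally have "real (16 * (t ^ d + 1)\<^sup>2) \<le> real n"
    by (simp add: power2_eq_square algebra_simps)
  then show ?thesis
    unfolding t_def of_nat_le_iff .
qed

section \<open>Circuits with one-sided error\<close>

text \<open>The condition on \<open>n\<close> allows a radius \<open>k\<close> for which Hamming
  balls fill a quarter of the cube while the degrees still add up to less than \<open>n / 2\<close>.
  This gives \<open>card S \<le> 4 * card E\<close>.\<close>

lemma one_sided_count:
  assumes p: "prime p" "odd p" and C: "circuit_on n C" and r: "r \<ge> 1"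
    and n: "16 * ((r * (p - 1)) ^ depth C + 1)\<^sup>2 \<le> n"
    and sub: "{x \<in> cube n. circuit_value p C x} \<subseteq> {x \<in> cube n. parity x}"
  shows "2 ^ r * card {x \<in> cube n. circuit_value p C x} \<le> 4 * (num_gates C * 2 ^ n)"
proof -
  define S where "S = {x \<in> cube n. circuit_value p C x}"
  obtain E q where E: "E \<subseteq> cube n" "2 ^ r * card E \<le> num_gates C * 2 ^ n"
      and q: "degree_le ((r * (p - 1)) ^ depth C) q" "computes_mod p (cube n - E) q (circuit_value p C)"
    using circuit_approximation[OF p(1) C r] by blast
  obtain k where k: "2 * ((r * (p - 1)) ^ depth C + k) < n" "2 ^ n \<le> 4 * (\<Sum>i\<le>k. n choose i)"
    using sum_binomial_lower[OF n] by blast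
  have "card S * 2 ^ n \<le> card S * (4 * (\<Sum>i\<le>k. n choose i))"
    using k(2) by (rule mult_le_mono2)
  also have "\<dots> = 4 * (card S * (\<Sum>i\<le>k. n choose i))"
    by (simp only: mult.left_commute)
  also have "card S * (\<Sum>i\<le>k. n choose i) \<le> 2 ^ n * card E"
    by (rule odd_support_bound[OF p q(1) k(1) _ E(1)])
      (use sub q(2) in \<open>auto simp: S_def computes_mod_def\<close>)
  finally have "card S \<le> 4 * card E"
    by simp
  then have "2 ^ r * card S \<le> 2 ^ r * (4 * card E)"
    by (rule mult_le_mono2)
  also have "\<dots> = 4 * (2 ^ r * card E)"
    by (simp only: mult.left_commute)
  also have "\<dots> \<le> 4 * (num_gates C * 2 ^ n)"
    using E(2) by (rule mult_le_mono2)
  finally show ?thesis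
    by (simp only: S_def)
qed

text \<open>With one-sided error, agreement occurs at all even points and, disjointly, at the
  accepted points.\<close>

lemma prob_agree_parity:
  assumes n: "n \<ge> 1" and sub: "{x \<in> cube n. f x} \<subseteq> {x \<in> cube n. parity x}"
  shows "measure_pmf.prob (pmf_of_set (cube n)) {x. f x = parity x}
    = 1 / 2 + real (card {x \<in> cube n. f x}) / 2 ^ n"
proof -
  have "cube n \<inter> {x. f x = parity x} = {x \<in> cube n. \<not> parity x} \<union> {x \<in> cube n. f x}"
    using sub by auto
  then have "card (cube n \<inter> {x. f x = parity x})
      = card {x \<in> cube n. \<not> parity x} + card {x \<in> cube n. f x}"
    using sub by (simp only:) (rule card_Un_disjoint, auto)
  moreover have "2 * real (card {x \<in> cube n. \<not> parity x}) = 2 ^ n"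
    using card_even_points(1)[of n] n by (simp flip: of_nat_eq_iff[where 'a = real])
  ultimately show ?thesis
    by (simp add: measure_pmf_of_set field_simps)
qed

theorem theorem1p4:
  fixes p :: nat
  assumes "prime p" and "odd p"
  shows "\<exists>c::real. c > 0 \<and>
    (\<forall>(d::nat) (n::nat) (C::circuit).
       d \<ge> 1 \<longrightarrow> circuit_on n C \<longrightarrow> depth C = d \<longrightarrow>
       {x \<in> cube n. circuit_value p C x} \<subseteq> {x \<in> cube n. parity x} \<longrightarrow>
       measure_pmf.prob (pmf_of_set (cube n)) {x. circuit_value p C x = parity x}
         \<le> 1 / 2 + real (num_gates C) * 2 powr (- (real n powr (c / real d))))"
proof (intro exI conjI allI impI)
  \<comment> \<open>Depends on \<open>p\<close> alone; \<open>12 + 2 * p\<close> is twice the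
    exponent \<open>6 + p\<close> because the degree must stay below the order of
    \<open>sqrt n\<close>.\<close>
  let ?c = "1 / real (12 + 2 * p)"
  show "?c > 0"
    by simp
  fix d n :: nat and C :: circuit
  assume d: "d \<ge> 1" and C: "circuit_on n C" and depth: "depth C = d"
    and sub: "{x \<in> cube n. circuit_value p C x} \<subseteq> {x \<in> cube n. parity x}"
  define s where "s = num_gates C"
  define S where "S = {x \<in> cube n. circuit_value p C x}"
  define y where "y = real n powr (?c / real d)"
  have "depth C \<ge> 1"
    using d depth by simp
  with C obtain j where "j < num_gates C" "out_node C = Gate j"
    by (rule out_node_is_gate)
  then have s: "s \<ge> 1"
    by (simp add: s_def)
  show "measure_pmf.prob (pmf_of_set (cube n)) {x. circuit_value p C x = parity x}
      \<le> 1 / 2 + real (num_gates C) * 2 powr (- (real n powr (?c / real d)))"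
  proof (cases "n = 0")
    \<comment> \<open>As \<open>0 powr _\<close> is 0, the claimed bound is \<open>1 / 2 + s\<close>
      with \<open>s \<ge> 1\<close>.\<close>
    case True
    have "measure_pmf.prob (pmf_of_set (cube n)) {x. circuit_value p C x = parity x} \<le> 1"
      by simp
    also have "\<dots> \<le> 1 / 2 + real s"
      using s by simp
    finally show ?thesis
      using True by (simp add: s_def)
  next
    case False
    then have n: "n \<ge> 1"
      by simp
    have half: "real (card S) / 2 ^ n \<le> 1 / 2"
    proof -
      have "card S \<le> card {x \<in> cube n. parity x}"
        using sub by (auto simp: S_def intro: card_mono)
      then have "2 * card S \<le> 2 ^ n"
        using card_even_points(2)[of n] n by linarith
      then have "2 * real (card S) \<le> 2 ^ n"
        by (simp flip: of_nat_le_iff[where 'a = real])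
      then show ?thesis
        by (simp add: field_simps)
    qed
    have y_le_n: "y \<le> real n"
    proof -
      have "?c / real d \<le> 1"
        using d mult_mono[of 1 "real (12 + 2 * p)" 1 "real d"] by (simp add: divide_simps)
      then have "y \<le> real n powr 1"
        unfolding y_def using n by (intro powr_mono) simp_all
      then show ?thesis
        using n by simp
    qed
    have "real (card S) / 2 ^ n \<le> real s * 2 powr - y"
    \<comment> \<open>The polynomial method handles large \<open>y\<close>. For
      \<open>y \<le> 2\<close> the factor \<open>2 powr - y\<close> is at least 1/4, so two gates
      already make the bound trivial.\<close>
    proof (cases "y > 2")
      case True
      \<comment> \<open>The additional 2 pays for the factor 4 in
        \<open>one_sided_count\<close>.\<close>
      define r where "r = nat \<lceil>y\<rceil> + 2"
      have "2 ^ r * card S \<le> 4 * (s * 2 ^ n)"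
        unfolding S_def s_def
      proof (rule one_sided_count[OF assms C _ _ sub])
        show "16 * ((r * (p - 1)) ^ depth C + 1)\<^sup>2 \<le> n"
          unfolding r_def depth
          by (rule degree_estimate[OF prime_gt_1_nat[OF assms(1)] d n y_def True])
      qed (simp add: r_def)
      then have "2 ^ r * real (card S) \<le> 4 * (real s * 2 ^ n)"
        by (simp flip: of_nat_le_iff[where 'a = real])
      then have "real (card S) / 2 ^ n \<le> real s * (4 / 2 ^ r)"
        by (simp add: field_simps)
      also have "4 / 2 ^ r = (2 :: real) powr - real (nat \<lceil>y\<rceil>)"
        by (simp add: r_def power_add powr_minus powr_realpow divide_simps)
      also have "real s * \<dots> \<le> real s * 2 powr - y"
        by (intro mult_left_mono powr_mono) linarith+
      finally show ?thesis .
    next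
      case False
      show ?thesis
      \<comment> \<open>A single gate needs the direct count, which gives density at most
        \<open>2 powr - n\<close>. For \<open>n = 1\<close>, \<open>y\<close> is 1 and one gate
        suffices for the trivial bound.\<close>
      proof (cases "s = 1 \<and> n \<ge> 2")
        case True
        then have "card S \<le> 1"
          using single_gate_bound[OF assms C \<open>depth C \<ge> 1\<close> _ _ sub] by (simp add: S_def s_def)
        then have "real (card S) / 2 ^ n \<le> 2 powr - real n"
          by (simp add: powr_minus powr_realpow divide_simps)
        also have "\<dots> \<le> 2 powr - y"
          using y_le_n by (intro powr_mono) simp_all
        finally show ?thesis
          using True by simp
      next
        case not_single: False
        have "1 / 2 \<le> real s * 2 powr - y"
        proof (cases "n = 1")
          case True
          then have "y = 1"
            by (simp add: y_def)
          then show ?thesis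
            using s by (simp add: powr_minus)
        next
          case False
          then have "2 \<le> real s"
            using not_single n s by auto
          moreover have "(2 :: real) powr - 2 \<le> 2 powr - y"
            using \<open>\<not> y > 2\<close> by (intro powr_mono) simp_all
          ultimately have "2 * (2 powr - 2) \<le> real s * 2 powr - y"
            by (intro mult_mono) simp_all
          then show ?thesis
            by (simp add: powr_minus)
        qed
        with half show ?thesis
          by linarith
      qed
    qed
    then show ?thesis
      using prob_agree_parity[OF n sub] by (simp add: S_def s_def y_def)
  qed
qed

end
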